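(* Let $G$ and $H$ be graphs with adjacency matrices $A_G$ and $A_H$ and partially coherent algebras $\hat{\mathcal A}_G$ and $\hat{\mathcal A}_H$ respectively. Then $G\cong_{\mathcal S_+}H$ if and only if there exists a linear bijection $\phi:\hat{\mathcal A}_G\to\hat{\mathcal A}_H$ such that 1. $\phi(M^\dagger)=\phi(M)^\dagger$ for all $M\in\hat{\mathcal A}_G$; 2. $\phi(MN)=\phi(M)\phi(N)$ for all $M,N\in\hat{\mathcal A}_G$; 3. $\phi(I)=I$, $\phi(A_G)=A_H$, and $\phi(J)=J$; 4. $\phi(M\bullet N)=\phi(M)\bullet\phi(N)$ for all $M\in\{I,A_G\}$ and $N\in\hat{\mathcal A}_G$.
   Context: Graphs are finite, simple and undirected. For vertices $x,y$ of the same graph, $\mathrm{rel}(x,y)$ denotes their relationship: equal, adjacent, or distinct non-adjacent. $\mathcal S_+$ is the cone of (Hermitian) positive semidefinite matrices. $G\cong_{\mathcal S_+}H$ means: there is a matrix $M\in\mathcal S_+$ with rows and columns indexed by $V_G\times V_H$ such that $\sum_{h,h'\in V_H}M_{gh,g'h'}=1$ for all $g,g'\in V_G$; $\sum_{g,g'\in V_G}M_{gh,g'h'}=1$ for all $h,h'\in V_H$; and $M_{gh,g'h'}=0$ whenever $\mathrm{rel}(g,g')\neq\mathrm{rel}(h,h')$. $I$ is the identity matrix, $J$ the all-ones matrix, $\bullet$ the Schur (entrywise) product. The partially coherent algebra $\hat{\mathcal A}_G$ of a graph $G$ on $n$ vertices is the smallest (i.e. the intersection of all) linear subspace(s) of $\mathbb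 C^{n\times n}$ that are closed under matrix multiplication, contain $I$ and $J$ (and $A_G$), are closed under conjugate transpose, and are closed under Schur multiplication by the matrices $I$ and $A_G$. *)

theory Defs
  imports "HOL-Analysis.Analysis"
begin

text \<open>A graph is given by its adjacency relation on a finite type of vertices.\<close>

definition simple_graph :: "('v::finite \<Rightarrow> 'v \<Rightarrow> bool) \<Rightarrow> bool" where
  "simple_graph E \<longleftrightarrow> symp E \<and> irreflp E"

definition adj_matrix :: "('v::finite \<Rightarrow> 'v \<Rightarrow> bool) \<Rightarrow> complex^'v^'v" where
  "adj_matrix E = (\<chi> x y. if E x y then 1 else 0)"

datatype relationship = Equal | Adjacent | Nonadjacent

definition rel :: "('v \<Rightarrow> 'v \<Rightarrow> bool) \<Rightarrow> 'v \<Rightarrow> 'v \<Rightarrow> relationship" where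
  "rel E x y = (if x = y then Equal else if E x y then Adjacent else Nonadjacent)"

definition mat_scale :: "complex \<Rightarrow> complex^'n^'m \<Rightarrow> complex^'n^'m" (infixr "*\<^sub>m" 75) where
  "c *\<^sub>m M = map_matrix (\<lambda>x. c * x) M"

interpretation cmat: vector_space "mat_scale :: complex \<Rightarrow> complex^'n^'m \<Rightarrow> complex^'n^'m"
  by unfold_locales (simp_all add: mat_scale_def vec_eq_iff algebra_simps)

definition ctranspose :: "complex^'n^'m \<Rightarrow> complex^'m^'n" where
  "ctranspose M = map_matrix cnj (transpose M)"

text \<open>The operations of the ring structure on vectors are componentwise. Hence, on matrices,
  \<open>*\<close> is the Schur product (the matrix product is \<open>**\<close>) and \<open>1\<close> is the all-ones matrix
  (the identity is \<open>mat 1\<close>).\<close>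

abbreviation schur :: "complex^'n^'m \<Rightarrow> complex^'n^'m \<Rightarrow> complex^'n^'m" (infixl "\<odot>" 70) where
  "M \<odot> N \<equiv> M * N"

abbreviation all_ones :: "complex^'n^'m" where
  "all_ones \<equiv> 1"

lemma schur_nth: "(M \<odot> N) $ i $ j = M $ i $ j * N $ i $ j"
  by simp

lemma all_ones_nth: "all_ones $ i $ j = 1"
  by simp

definition hermitian :: "complex^'n^'n \<Rightarrow> bool" where
  "hermitian M \<longleftrightarrow> ctranspose M = M"

definition psd :: "complex^'n^'n \<Rightarrow> bool" where
  "psd M \<longleftrightarrow> hermitian M \<and>
     (\<forall>v. (\<Sum>i\<in>UNIV. \<Sum>j\<in>UNIV. cnj (v $ i) * M $ i $ j * v $ j) \<in> \<real>\<^sub>\<ge>\<^sub>0)"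

definition psd_isomorphic ::
  "('g::finite \<Rightarrow> 'g \<Rightarrow> bool) \<Rightarrow> ('h::finite \<Rightarrow> 'h \<Rightarrow> bool) \<Rightarrow> bool" where
  "psd_isomorphic G H \<longleftrightarrow> (\<exists>M :: complex^('g \<times> 'h)^('g \<times> 'h). psd M \<and>
     (\<forall>g g'. (\<Sum>h\<in>UNIV. \<Sum>h'\<in>UNIV. M $ (g, h) $ (g', h')) = 1) \<and>
     (\<forall>h h'. (\<Sum>g\<in>UNIV. \<Sum>g'\<in>UNIV. M $ (g, h) $ (g', h')) = 1) \<and>
     (\<forall>g h g' h'. rel G g g' \<noteq> rel H h h' \<longrightarrow> M $ (g, h) $ (g', h') = 0))"

definition partially_coherent :: "('v::finite \<Rightarrow> 'v \<Rightarrow> bool) \<Rightarrow> (complex^'v^'v) set \<Rightarrow> bool" where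
  "partially_coherent G S \<longleftrightarrow>
     cmat.subspace S \<and>
     (\<forall>M\<in>S. \<forall>N\<in>S. M ** N \<in> S) \<and>
     mat 1 \<in> S \<and> all_ones \<in> S \<and> adj_matrix G \<in> S \<and>
     (\<forall>M\<in>S. ctranspose M \<in> S) \<and>
     (\<forall>M\<in>{mat 1, adj_matrix G}. \<forall>N\<in>S. M \<odot> N \<in> S)"

definition partially_coherent_algebra :: "('v::finite \<Rightarrow> 'v \<Rightarrow> bool) \<Rightarrow> (complex^'v^'v) set" where
  "partially_coherent_algebra G = \<Inter> {S. partially_coherent G S}"

end

(* From an isomorphism \<phi> to M: if X_1, ..., X_k is a Parseval frame of the partially coherent algebra
   for the Hilbert-Schmidt inner product, put M = \<Sum>_i conj(X_i) (x) \<phi>(X_i), the Choi matrix of \<phi>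
   composed with the orthogonal projection onto the algebra. It is Hermitian and satisfies
   M^2 = (conj(C) (x) I) M with C = \<Sum>_i X_i X_i^* positive semidefinite. An eigenvector of M for an
   eigenvalue \<mu> < 0 would therefore be one of conj(C) (x) I for \<mu>, which is impossible.

   From M to \<phi>: M is the Choi matrix of a completely positive map \<Phi>, and the conditions on M say that
   \<Phi> and its adjoint \<Phi>^* fix I, J and A and respect Schur multiplication by I and A. If \<Phi>(X) = Y and
   \<Phi>^*(Y) = X, then the sum of the nonnegative values of the form M at the vectors expressing that the
   Kraus operators of \<Phi> intertwine X and Y is |X|^2 - |Y|^2 = 0, so M kills these vectors. Hence such
   pairs (X, Y) are closed under products, and the X occurring in them with Y in the algebra of H form
   a partially coherent subspace, which contains the algebra of G. *)
theory Submission
  imports Defs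
begin

subsection \<open>Positive semidefinite matrices\<close>

definition cdot :: "complex^'n \<Rightarrow> complex^'n \<Rightarrow> complex" where
  "cdot u v = (\<Sum>i\<in>UNIV. cnj (u $ i) * v $ i)"

lemma mat_scale_nth [simp]: "(c *\<^sub>m M) $ i $ j = c * M $ i $ j"
  by (simp add: mat_scale_def)

lemma ctranspose_nth [simp]: "ctranspose M $ i $ j = cnj (M $ j $ i)"
  by (simp add: ctranspose_def transpose_def)

lemma adj_matrix_nth [simp]: "adj_matrix E $ x $ y = (if E x y then 1 else 0)"
  by (simp add: adj_matrix_def)

lemma mat_nth: "(mat c :: complex^'n^'n) $ i $ j = (if i = j then c else 0)"
  by (simp add: mat_def)

lemma ctranspose_ctranspose [simp]: "ctranspose (ctranspose M) = M"
  by (simp add: vec_eq_iff)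

lemma hermitianD: "hermitian M \<Longrightarrow> cnj (M $ i $ j) = M $ j $ i"
  unfolding hermitian_def by (metis ctranspose_nth)

lemma cdot_add_left: "cdot (u + v) w = cdot u w + cdot v w"
  by (simp add: cdot_def algebra_simps sum.distrib)

lemma cdot_add_right: "cdot w (u + v) = cdot w u + cdot w v"
  by (simp add: cdot_def algebra_simps sum.distrib)

lemma cdot_scale_left: "cdot (c *s u) w = cnj c * cdot u w"
  by (simp add: cdot_def sum_distrib_left mult.assoc)

lemma cdot_scale_right: "cdot w (c *s u) = c * cdot w u"
  by (simp add: cdot_def sum_distrib_left mult_ac)

lemma cnj_cdot: "cnj (cdot u v) = cdot v u"
  by (simp add: cdot_def mult.commute)

lemma cdot_self: "cdot v v = complex_of_real ((norm v)\<^sup>2)"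
  by (simp add: cdot_def norm_vec_def L2_set_def sum_nonneg complex_norm_square mult.commute
      del: of_real_power)

lemma cdot_hermitian:
  assumes "hermitian M"
  shows "cdot (M *v u) w = cdot u (M *v w)"
proof -
  have "cdot (M *v u) w = (\<Sum>i\<in>UNIV. \<Sum>j\<in>UNIV. cnj (u $ j) * (M $ j $ i * w $ i))"
    by (simp add: cdot_def matrix_vector_mult_def sum_distrib_left sum_distrib_right hermitianD[OF assms] mult_ac)
  also have "\<dots> = cdot u (M *v w)"
    by (subst sum.swap) (simp add: cdot_def matrix_vector_mult_def sum_distrib_left)
  finally show ?thesis .
qed

lemma psd_iff_cdot:
  "psd M \<longleftrightarrow> hermitian M \<and> (\<forall>v. cdot v (M *v v) \<in> \<real>\<^sub>\<ge>\<^sub>0)"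
  by (simp add: psd_def cdot_def matrix_vector_mult_def sum_distrib_left mult.assoc)

lemma cdot_hermitian_real:
  assumes "hermitian M"
  shows "cdot v (M *v v) = of_real (Re (cdot v (M *v v)))"
  using cnj_cdot[of v "M *v v"] cdot_hermitian[OF assms, of v v]
  by (simp add: complex_eq_iff)

text \<open>Moving from \<open>v\<close> by \<open>- t\<close> times \<open>w = M *v v\<close>
  changes the form, which is zero at \<open>v\<close>, by \<open>- 2 * t * |w|^2\<close> to first
  order. Unless \<open>w = 0\<close>, it turns negative for small positive \<open>t\<close>.\<close>

lemma psd_cdot_eq_0:
  assumes "psd M" and "cdot v (M *v v) = 0"
  shows "M *v v = 0"
proof -
  have herm: "hermitian M" and pos: "\<And>w. cdot w (M *v w) \<in> \<real>\<^sub>\<ge>\<^sub>0"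
    using assms(1) by (auto simp: psd_iff_cdot)
  define w where "w = M *v v"
  define a where "a = (norm w)\<^sup>2"
  define b where "b = Re (cdot w (M *v w))"
  have b: "b \<ge> 0" "cdot w (M *v w) = of_real b"
    using pos[of w] by (auto simp: b_def complex_nonneg_Reals_iff complex_eq_iff)
  have ineq: "- 2 * t * a + t\<^sup>2 * b \<ge> 0" for t :: real
  proof -
    define c where "c = - complex_of_real t"
    have [simp]: "cnj c = c" by (simp add: c_def)
    have vMw: "cdot v (M *v w) = of_real a"
      by (metis cdot_hermitian[OF herm] w_def cdot_self a_def)
    have "cdot (v + c *s w) (M *v (v + c *s w))
        = cdot v w + c * of_real a + c * (of_real a + c * of_real b)"
      by (simp add: matrix_vector_right_distrib vector_scalar_commute cdot_add_left cdot_add_right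
          cdot_scale_left cdot_scale_right b vMw flip: w_def)
         (simp add: cdot_self a_def)
    also have "\<dots> = of_real (- 2 * t * a + t\<^sup>2 * b)"
      using assms(2) by (simp add: w_def c_def algebra_simps power2_eq_square)
    finally show ?thesis
      using pos[of "v + c *s w"] by (metis nonneg_Reals_of_real_iff)
  qed
  have "a = 0"
  proof (rule ccontr)
    assume "a \<noteq> 0"
    then have a: "a > 0" by (simp add: a_def)
    \<comment> \<open>The \<open>+ 1\<close> keeps the denominator positive when
      \<open>b = 0\<close>; the form then takes the value \<open>- (t^2 * (b + 2))\<close>.\<close>
    define t where "t = a / (b + 1)"
    have t: "a = t * (b + 1)" "t \<noteq> 0"
      using a b by (auto simp: t_def)
    have "- 2 * t * a + t\<^sup>2 * b = - (t\<^sup>2 * (b + 2))"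
      by (subst t(1)) (simp add: algebra_simps power2_eq_square)
    also have "\<dots> < 0"
      using b t(2) by simp
    finally show False using ineq[of t] by simp
  qed
  then show ?thesis by (simp add: a_def w_def)
qed

text \<open>The form attains a negative minimum \<mu> on the unit sphere. Subtracting \<mu> times
  the identity leaves a positive semidefinite matrix whose form vanishes at the minimiser, so the
  minimiser is an eigenvector.\<close>

lemma hermitian_not_psd_eigenvector:
  fixes M :: "complex^'n^'n"
  assumes "hermitian M" and "\<not> psd M"
  obtains v \<mu> where "v \<noteq> 0" "\<mu> < 0" "M *v v = complex_of_real \<mu> *s v"
proof -
  define q where "q v = Re (cdot v (M *v v))" for v
  have q: "cdot v (M *v v) = of_real (q v)" for v
    using cdot_hermitian_real[OF assms(1)] by (simp add: q_def)
  have q_scale: "q (complex_of_real c *s v) = c\<^sup>2 * q v" for c v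
    by (simp add: q_def vector_scalar_commute cdot_scale_left cdot_scale_right
        power2_eq_square)
  have norm_scale: "norm (complex_of_real c *s v) = \<bar>c\<bar> * norm v" for c and v :: "complex^'n"
    by (simp add: norm_vec_def norm_mult L2_set_right_distrib)
  obtain u where u: "q u < 0"
    using assms by (auto simp: psd_iff_cdot q not_le)
  then have "u \<noteq> 0" by (auto simp: q_def cdot_def)
  have cont: "continuous_on (sphere 0 1) q"
    unfolding q_def cdot_def matrix_vector_mult_def
    by (intro continuous_intros)
  define u1 where "u1 = complex_of_real (1 / norm u) *s u"
  have u1: "u1 \<in> sphere 0 1" 
    using \<open>u \<noteq> 0\<close> unfolding u1_def mem_sphere_0 norm_scale by simp
  obtain v where v: "v \<in> sphere 0 1" and min: "\<And>w. w \<in> sphere 0 1 \<Longrightarrow> q v \<le> q w"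
    using continuous_attains_inf[OF compact_sphere _ cont] u1 by (metis empty_iff)
  define \<mu> where "\<mu> = q v"
  have "q u1 < 0"
    using u \<open>u \<noteq> 0\<close> unfolding u1_def q_scale by (simp add: field_simps)
  then have "\<mu> < 0"
    using min[OF u1] by (simp add: \<mu>_def)
  \<comment> \<open>The bound on the sphere extends to all vectors because \<open>q\<close> is
    homogeneous of degree two under real scaling.\<close>
  have lower: "\<mu> * (norm w)\<^sup>2 \<le> q w" for w
  proof (cases "w = 0")
    case False
    have "complex_of_real (1 / norm w) *s w \<in> sphere 0 1"
      using False unfolding mem_sphere_0 norm_scale by simp
    then have "\<mu> \<le> (1 / norm w)\<^sup>2 * q w"
      using min unfolding \<mu>_def by (metis q_scale)
    then show ?thesis
      using False by (simp add: field_simps)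
  qed (simp add: q_def cdot_def)
  define N where "N = M - mat (complex_of_real \<mu>)"
  have mat_vec: "mat c *v w = c *s w" for c :: complex and w :: "complex^'n"
    by (simp add: vec_eq_iff matrix_vector_mult_def mat_nth if_distrib[of "\<lambda>x. x * _"] cong: if_cong)
  have Nv: "N *v w = M *v w + complex_of_real (- \<mu>) *s w" for w
    by (simp add: N_def matrix_vector_mult_diff_rdistrib mat_vec vec_eq_iff)
  have Nq: "cdot w (N *v w) = of_real (q w - \<mu> * (norm w)\<^sup>2)" for w
    by (simp add: Nv cdot_add_right cdot_scale_right q cdot_self del: of_real_minus) simp
  have "hermitian N"
    unfolding hermitian_def N_def
    by (auto simp: vec_eq_iff mat_nth hermitianD[OF assms(1)])
  then have "psd N"
    using lower by (simp add: psd_iff_cdot Nq del: of_real_diff of_real_mult of_real_power)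
  moreover have "cdot v (N *v v) = 0"
    using v unfolding Nq by (simp add: \<mu>_def)
  ultimately have "N *v v = 0" by (rule psd_cdot_eq_0)
  then have "M *v v = complex_of_real \<mu> *s v"
    by (simp add: Nv vec_eq_iff add_eq_0_iff)
  moreover have "v \<noteq> 0" using v by auto
  ultimately show ?thesis using \<open>\<mu> < 0\<close> that by blast
qed

subsection \<open>Frames for the Hilbert--Schmidt inner product\<close>

definition hs :: "complex^'n^'m \<Rightarrow> complex^'n^'m \<Rightarrow> complex" where
  "hs X Y = (\<Sum>i\<in>UNIV. \<Sum>j\<in>UNIV. cnj (X $ i $ j) * Y $ i $ j)"

lemma hs_scale_right: "hs X (c *\<^sub>m Y) = c * hs X Y"
  by (simp add: hs_def sum_distrib_left mult_ac)

lemma cnj_hs: "cnj (hs X Y) = hs Y X"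
  by (simp add: hs_def mult.commute)

lemma inner_eq_hs: "inner X Y = Re (hs X Y)" for X Y :: "complex^'n^'m"
  by (simp add: inner_vec_def hs_def inner_complex_def)

lemma scaleR_eq_mat_scale: "r *\<^sub>R X = complex_of_real r *\<^sub>m X" for X :: "complex^'n^'m"
  unfolding vec_eq_iff vector_scaleR_component mat_scale_nth by (simp add: scaleR_conv_of_real)

text \<open>This is the Parseval frame from which the Choi matrix is built. Its members are in
  general linearly dependent over the complex numbers; what matters is the expansion
  formula.\<close>

lemma hs_frame:
  fixes A :: "(complex^'n^'m) set"
  assumes "cmat.subspace A"
  obtains B where "finite B" "B \<subseteq> A" "\<And>Y. Y \<in> A \<Longrightarrow> (\<Sum>X\<in>B. hs X Y *\<^sub>m X) = Y"
proof -
  have "subspace A"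
    using assms by (auto simp: subspace_def cmat.subspace_def scaleR_eq_mat_scale)
  then obtain C where C: "C \<subseteq> A" "pairwise orthogonal C" "\<And>X. X \<in> C \<Longrightarrow> norm X = 1"
    "independent C" "span C = A"
    by (metis orthonormal_basis_subspace)
  have fin: "finite C" using C(4) by (rule independent_imp_finite)
  have expand: "(\<Sum>X\<in>C. complex_of_real (Re (hs X Y)) *\<^sub>m X) = Y" if "Y \<in> A" for Y
  proof -
    define D where "D = Y - (\<Sum>X\<in>C. (inner X Y / inner X X) *\<^sub>R X)"
    have "D \<in> span C"
      unfolding D_def using that C(5)
      by (auto intro!: span_diff span_sum span_scale intro: span_base)
    \<comment> \<open>The remainder \<open>D\<close> lies in the span of \<open>C\<close> and is
      orthogonal to that span, hence to itself.\<close>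
    then have "D = 0"
      using Gram_Schmidt_step[OF C(2), of D Y] by (simp add: orthogonal_self flip: D_def)
    moreover have "inner X X = 1" if "X \<in> C" for X
      using C(3)[OF that] by (simp add: norm_eq_sqrt_inner)
    ultimately have "Y = (\<Sum>X\<in>C. inner X Y *\<^sub>R X)"
      by (simp add: D_def)
    then show ?thesis
      by (simp add: inner_eq_hs scaleR_eq_mat_scale)
  qed
  \<comment> \<open>Viewed over the reals, a complex subspace has an orthonormal basis which is a tight complex
    frame with constant 2: applying the expansion to \<open>Y\<close> and to \<open>- \<i> Y\<close> gives the real and the imaginary
    parts of the coefficients. This avoids complex Gram--Schmidt.\<close>
  have double: "(\<Sum>X\<in>C. hs X Y *\<^sub>m X) = 2 *\<^sub>m Y" if "Y \<in> A" for Y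
  proof -
    have Y': "- \<i> *\<^sub>m Y \<in> A" using assms that by (rule cmat.subspace_scale)
    have "hs X Y = of_real (Re (hs X Y)) + \<i> * of_real (Re (hs X (- \<i> *\<^sub>m Y)))" for X
      by (simp add: hs_scale_right complex_eq_iff del: cmat.scale_minus_left)
    then have "(\<Sum>X\<in>C. hs X Y *\<^sub>m X)
      = (\<Sum>X\<in>C. (of_real (Re (hs X Y)) + \<i> * of_real (Re (hs X (- \<i> *\<^sub>m Y)))) *\<^sub>m X)"
      by simp
    also have "\<dots> = (\<Sum>X\<in>C. of_real (Re (hs X Y)) *\<^sub>m X)
        + \<i> *\<^sub>m (\<Sum>X\<in>C. of_real (Re (hs X (- \<i> *\<^sub>m Y))) *\<^sub>m X)"
      by (simp add: cmat.scale_left_distrib sum.distrib cmat.scale_sum_right)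
    also have "\<dots> = 2 *\<^sub>m Y"
      unfolding expand[OF that] expand[OF Y'] by (simp add: vec_eq_iff)
    finally show ?thesis .
  qed
  \<comment> \<open>The scalar enters both the coefficient and the vector, so scaling by
    \<open>s\<close> contributes \<open>s * s = 1 / 2\<close> and turns the frame constant 2 into
    1.\<close>
  define s where "s = complex_of_real (1 / sqrt 2)"
  have s: "s \<noteq> 0" "s * s = 1 / 2" "cnj s = s"
    by (simp_all add: s_def flip: of_real_mult)
  have inj: "inj_on ((*\<^sub>m) s) C"
    using s(1) by (simp add: inj_on_def)
  show ?thesis
  proof
    show "finite ((*\<^sub>m) s ` C)" using fin by simp
    show "(*\<^sub>m) s ` C \<subseteq> A" using C(1) assms by (auto intro: cmat.subspace_scale)
    show "(\<Sum>X\<in>(*\<^sub>m) s ` C. hs X Y *\<^sub>m X) = Y" if "Y \<in> A" for Y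
    proof -
      have "(\<Sum>X\<in>(*\<^sub>m) s ` C. hs X Y *\<^sub>m X) = (\<Sum>X\<in>C. (1/2) *\<^sub>m (hs X Y *\<^sub>m X))"
      proof (subst sum.reindex[OF inj], rule sum.cong)
        fix X
        have "hs (s *\<^sub>m X) Y = s * hs X Y"
          by (metis cnj_hs complex_cnj_mult hs_scale_right s(3))
        then show "((\<lambda>X. hs X Y *\<^sub>m X) \<circ> (*\<^sub>m) s) X = (1/2) *\<^sub>m (hs X Y *\<^sub>m X)"
          using s(2) by (simp add: mult_ac flip: mult.assoc)
      qed simp
      also have "\<dots> = Y"
        by (simp only: double[OF that] cmat.scale_sum_right[symmetric]) simp
      finally show ?thesis .
    qed
  qed
qed

lemma linear_on_subspace_sum:
  assumes A: "cmat.subspace A"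
    and add: "\<And>X Y. X \<in> A \<Longrightarrow> Y \<in> A \<Longrightarrow> f (X + Y) = f X + f Y"
    and scale: "\<And>c X. X \<in> A \<Longrightarrow> f (c *\<^sub>m X) = c *\<^sub>m f X"
    and "finite B" "B \<subseteq> A"
  shows "f (\<Sum>X\<in>B. c X *\<^sub>m X) = (\<Sum>X\<in>B. c X *\<^sub>m f X)"
  using \<open>finite B\<close> \<open>B \<subseteq> A\<close>
proof induction
  case empty
  have "f (0 *\<^sub>m 0) = 0 *\<^sub>m f 0"
    using cmat.subspace_0[OF A] by (rule scale)
  then show ?case by simp
next
  case (insert X B)
  then have "(\<Sum>X\<in>B. c X *\<^sub>m X) \<in> A" "c X *\<^sub>m X \<in> A"
    using A by (auto intro!: cmat.subspace_sum cmat.subspace_scale)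
  with insert show ?case by (simp add: add scale)
qed

lemma sum_swap_pairs:
  fixes f :: "_ \<Rightarrow> _ \<Rightarrow> _ \<Rightarrow> _ \<Rightarrow> 'a::comm_monoid_add"
  shows "(\<Sum>a\<in>A. \<Sum>b\<in>B. \<Sum>c\<in>C. \<Sum>d\<in>D. f a b c d) = (\<Sum>c\<in>C. \<Sum>d\<in>D. \<Sum>a\<in>A. \<Sum>b\<in>B. f a b c d)"
proof -
  have "(\<Sum>p\<in>A\<times>B. \<Sum>q\<in>C\<times>D. f (fst p) (snd p) (fst q) (snd q))
      = (\<Sum>q\<in>C\<times>D. \<Sum>p\<in>A\<times>B. f (fst p) (snd p) (fst q) (snd q))"
    by (rule sum.swap)
  then show ?thesis
    by (simp add: sum.cartesian_product' del: sum.cartesian_product)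
qed

text \<open>Both sides are the trace of \<open>ctranspose Y ** ctranspose X ** Z\<close>. This
  supplies the adjoint pair needed for \<open>choi_square\<close>.\<close>

lemma hs_matrix_mult: "hs (X ** Y) Z = hs Y (ctranspose X ** Z)"
proof -
  have "hs (X ** Y) Z = (\<Sum>i\<in>UNIV. \<Sum>j\<in>UNIV. \<Sum>k\<in>UNIV. cnj (X $ i $ k) * cnj (Y $ k $ j) * Z $ i $ j)"
    by (simp add: hs_def matrix_matrix_mult_def sum_distrib_right)
  also have "\<dots> = (\<Sum>i\<in>UNIV. \<Sum>k\<in>UNIV. \<Sum>j\<in>UNIV. cnj (X $ i $ k) * cnj (Y $ k $ j) * Z $ i $ j)"
    by (intro sum.cong refl, rule sum.swap)
  also have "\<dots> = (\<Sum>k\<in>UNIV. \<Sum>j\<in>UNIV. \<Sum>i\<in>UNIV. cnj (X $ i $ k) * cnj (Y $ k $ j) * Z $ i $ j)"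
    by (subst sum.swap, intro sum.cong refl, rule sum.swap)
  also have "\<dots> = hs Y (ctranspose X ** Z)"
    by (simp add: hs_def matrix_matrix_mult_def sum_distrib_left mult_ac)
  finally show ?thesis .
qed

subsection \<open>The Choi matrix of an isomorphism\<close>

locale framed_homomorphism =
  fixes A B :: "(complex^'g^'g) set" and \<phi> :: "complex^'g^'g \<Rightarrow> complex^'h^'h"
  assumes subspace: "cmat.subspace A"
    and mult_closed: "\<And>X Y. X \<in> A \<Longrightarrow> Y \<in> A \<Longrightarrow> X ** Y \<in> A"
    and star_closed: "\<And>X. X \<in> A \<Longrightarrow> ctranspose X \<in> A"
    and \<phi>_add: "\<And>X Y. X \<in> A \<Longrightarrow> Y \<in> A \<Longrightarrow> \<phi> (X + Y) = \<phi> X + \<phi> Y"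
    and \<phi>_scale: "\<And>c X. X \<in> A \<Longrightarrow> \<phi> (c *\<^sub>m X) = c *\<^sub>m \<phi> X"
    and \<phi>_mult: "\<And>X Y. X \<in> A \<Longrightarrow> Y \<in> A \<Longrightarrow> \<phi> (X ** Y) = \<phi> X ** \<phi> Y"
    and \<phi>_star: "\<And>X. X \<in> A \<Longrightarrow> \<phi> (ctranspose X) = ctranspose (\<phi> X)"
    and finite_B: "finite B" and B_sub: "B \<subseteq> A"
    and frame: "\<And>Y. Y \<in> A \<Longrightarrow> (\<Sum>X\<in>B. hs X Y *\<^sub>m X) = Y"
begin

lemma BA: "X \<in> B \<Longrightarrow> X \<in> A"
  using B_sub by blast

lemma \<phi>_expand: "Y \<in> A \<Longrightarrow> \<phi> Y = (\<Sum>X\<in>B. hs X Y *\<^sub>m \<phi> X)"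
  using linear_on_subspace_sum[OF subspace \<phi>_add \<phi>_scale finite_B B_sub, of "\<lambda>X. hs X Y"]
  by (simp add: frame)

text \<open>The map \<open>U\<close> is arbitrary so that the lemma applies both to the linear maps \<open>L\<close> with adjoint \<open>L'\<close>
  and to the antilinear conjugate transpose.\<close>

lemma frame_exchange:
  assumes L: "\<And>Y. Y \<in> A \<Longrightarrow> L Y \<in> A" and L': "\<And>Y. Y \<in> A \<Longrightarrow> L' Y \<in> A"
    and U: "\<And>f. U (\<Sum>Y\<in>B. f Y) = (\<Sum>Y\<in>B. U (f Y))"
    and adj: "\<And>Y Z. Y \<in> A \<Longrightarrow> Z \<in> A \<Longrightarrow> hs (L Y) Z *\<^sub>m U Y = U (hs Y (L' Z) *\<^sub>m Y)"
  shows "(\<Sum>Y\<in>B. cnj (U Y $ i $ j) * \<phi> (L Y) $ k $ l)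
    = (\<Sum>Z\<in>B. cnj (U (L' Z) $ i $ j) * \<phi> Z $ k $ l)"
proof -
  \<comment> \<open>Expand \<open>\<phi> (L Y)\<close> in the frame, let \<open>adj\<close> move the
    coefficient into the first factor, and sum over \<open>Y\<close> by the frame identity for
    \<open>L' Z\<close>.\<close>
  have "(\<Sum>Y\<in>B. cnj (U Y $ i $ j) * \<phi> (L Y) $ k $ l)
     = (\<Sum>Y\<in>B. \<Sum>Z\<in>B. cnj (U Y $ i $ j) * (hs Z (L Y) * \<phi> Z $ k $ l))"
    by (rule sum.cong) (auto simp: \<phi>_expand[OF L] BA sum_distrib_left)
  also have "\<dots> = (\<Sum>Z\<in>B. \<Sum>Y\<in>B. cnj ((hs (L Y) Z *\<^sub>m U Y) $ i $ j) * \<phi> Z $ k $ l)"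
    by (subst sum.swap) (simp add: cnj_hs mult_ac)
  also have "\<dots> = (\<Sum>Z\<in>B. cnj ((\<Sum>Y\<in>B. U (hs Y (L' Z) *\<^sub>m Y)) $ i $ j) * \<phi> Z $ k $ l)"
    by (rule sum.cong) (simp_all add: adj BA sum_distrib_right del: mat_scale_nth)
  also have "\<dots> = (\<Sum>Z\<in>B. cnj (U (L' Z) $ i $ j) * \<phi> Z $ k $ l)"
    by (rule sum.cong) (simp_all add: frame L' BA flip: U)
  finally show ?thesis .
qed

definition choi :: "complex^('g \<times> 'h)^('g \<times> 'h)" where
  "choi = (\<chi> p q. \<Sum>X\<in>B. cnj (X $ fst p $ fst q) * \<phi> X $ snd p $ snd q)"

lemma choi_nth: "choi $ (g, h) $ (g', h') = (\<Sum>X\<in>B. cnj (X $ g $ g') * \<phi> X $ h $ h')"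
  by (simp add: choi_def)

text \<open>Summing against \<open>Y\<close> turns the first tensor factor into the frame
  coefficients \<open>hs X Y\<close>, and what remains is the expansion of \<open>\<phi> Y\<close>.
  Taking \<open>Y = all_ones\<close> gives the sums over the first vertex set.\<close>

lemma choi_transfer:
  assumes "Y \<in> A"
  shows "(\<Sum>g\<in>UNIV. \<Sum>g'\<in>UNIV. choi $ (g, h) $ (g', h') * Y $ g $ g') = \<phi> Y $ h $ h'"
proof -
  have "(\<Sum>g\<in>UNIV. \<Sum>g'\<in>UNIV. choi $ (g, h) $ (g', h') * Y $ g $ g')
     = (\<Sum>g\<in>UNIV. \<Sum>X\<in>B. \<Sum>g'\<in>UNIV. cnj (X $ g $ g') * Y $ g $ g' * \<phi> X $ h $ h')"
    by (intro sum.cong refl, subst sum.swap) (simp add: choi_nth sum_distrib_left sum_distrib_right mult_ac)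
  also have "\<dots> = (\<Sum>X\<in>B. hs X Y * \<phi> X $ h $ h')"
    by (subst sum.swap) (simp add: hs_def sum_distrib_right)
  also have "\<dots> = \<phi> Y $ h $ h'"
    by (simp add: \<phi>_expand[OF assms])
  finally show ?thesis .
qed

text \<open>The hypothesis says that \<open>Y\<close> is the image of \<open>W\<close> under the
  adjoint of \<open>\<phi>\<close> on \<open>A\<close>. Summing against the conjugate of
  \<open>W\<close> therefore leaves the conjugated frame expansion of \<open>Y\<close>.\<close>

lemma choi_cotransfer:
  assumes "Y \<in> A" "\<And>X. X \<in> A \<Longrightarrow> hs W (\<phi> X) = hs Y X"
  shows "(\<Sum>h\<in>UNIV. \<Sum>h'\<in>UNIV. choi $ (g, h) $ (g', h') * cnj (W $ h $ h')) = cnj (Y $ g $ g')"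
proof -
  have "(\<Sum>h\<in>UNIV. \<Sum>h'\<in>UNIV. choi $ (g, h) $ (g', h') * cnj (W $ h $ h'))
     = (\<Sum>h\<in>UNIV. \<Sum>X\<in>B. \<Sum>h'\<in>UNIV. cnj (X $ g $ g') * (cnj (W $ h $ h') * \<phi> X $ h $ h'))"
    by (intro sum.cong refl, subst sum.swap) (simp add: choi_nth sum_distrib_left sum_distrib_right mult_ac)
  also have "\<dots> = (\<Sum>X\<in>B. cnj (X $ g $ g') * hs W (\<phi> X))"
    by (subst sum.swap) (simp add: hs_def sum_distrib_left)
  also have "\<dots> = cnj ((\<Sum>X\<in>B. hs X Y *\<^sub>m X) $ g $ g')"
    by (simp add: assms(2) BA cnj_hs mult.commute)
  finally show ?thesis by (simp add: frame assms(1))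
qed

text \<open>Schur multiplication by a real matrix is self-adjoint for \<open>hs\<close>, so it can
  be moved from one tensor factor of \<open>choi\<close> to the other. Consequently
  \<open>choi\<close> vanishes wherever \<open>P\<close> and \<open>Q\<close> differ.\<close>

lemma choi_schur:
  assumes "\<And>Y. Y \<in> A \<Longrightarrow> P \<odot> Y \<in> A" "\<And>Y. Y \<in> A \<Longrightarrow> \<phi> (P \<odot> Y) = Q \<odot> \<phi> Y"
    and "\<And>i j. cnj (P $ i $ j) = P $ i $ j"
  shows "P $ g $ g' * choi $ (g, h) $ (g', h') = Q $ h $ h' * choi $ (g, h) $ (g', h')"
proof -
  have "hs (P \<odot> Y) Z = hs Y (P \<odot> Z)" for Y Z
    by (simp add: hs_def assms(3) mult_ac)
  then have "(\<Sum>Y\<in>B. cnj (Y $ g $ g') * \<phi> (P \<odot> Y) $ h $ h')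
     = (\<Sum>Z\<in>B. cnj ((P \<odot> Z) $ g $ g') * \<phi> Z $ h $ h')"
    by (intro frame_exchange[where U = "\<lambda>Y. Y"]) (simp_all add: assms(1))
  then show ?thesis
    by (simp add: choi_nth assms(2,3) BA sum_distrib_left mult.assoc mult.left_commute[of "cnj _"])
qed

text \<open>Conjugate transposition is an antiunitary involution of \<open>A\<close> that commutes
  with \<open>\<phi>\<close>, so replacing the frame by its adjoints leaves \<open>choi\<close>
  unchanged.\<close>

lemma choi_hermitian: "hermitian choi"
proof -
  have adj: "hs (ctranspose Y) Z *\<^sub>m ctranspose Y = ctranspose (hs Y (ctranspose Z) *\<^sub>m Y)" for Y Z
  proof -
    have "hs (ctranspose Y) Z = cnj (hs Y (ctranspose Z))"
      by (simp add: hs_def mult.commute) (rule sum.swap)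
    then show ?thesis by (simp add: vec_eq_iff)
  qed
  have "(\<Sum>Y\<in>B. cnj (ctranspose Y $ g $ g') * \<phi> (ctranspose Y) $ h $ h')
     = (\<Sum>Z\<in>B. cnj (ctranspose (ctranspose Z) $ g $ g') * \<phi> Z $ h $ h')" for g g' h h'
    by (rule frame_exchange) (simp_all add: star_closed adj, simp add: vec_eq_iff)
  then have "cnj (choi $ (g', h') $ (g, h)) = choi $ (g, h) $ (g', h')" for g g' h h'
    by (simp add: choi_nth \<phi>_star BA)
  then show ?thesis
    by (simp add: hermitian_def vec_eq_iff)
qed

section \<open>Positive semidefiniteness of the Choi matrix\<close>

text \<open>Multiplicativity of \<open>\<phi>\<close> makes the square a sum over pairs
  \<open>X\<close>, \<open>Y\<close> of the conjugate of \<open>X ** Y\<close> tensored with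
  \<open>\<phi> (X ** Y)\<close>. For fixed \<open>X\<close>, \<open>frame_exchange\<close> for left
  multiplication by \<open>X\<close> clears \<open>X\<close> from the second factor and puts
  \<open>X ** ctranspose X\<close> in front of \<open>Y\<close> in the first.\<close>

lemma choi_square:
  "(choi ** choi) $ (g, h) $ q =
    (\<Sum>k\<in>UNIV. cnj ((\<Sum>X\<in>B. X ** ctranspose X) $ g $ k) * choi $ (k, h) $ q)"
proof -
  obtain g' h' where q: "q = (g', h')" by fastforce
  have "(choi ** choi) $ (g, h) $ q
     = (\<Sum>k\<in>UNIV. \<Sum>l\<in>UNIV. choi $ (g, h) $ (k, l) * choi $ (k, l) $ (g', h'))"
    by (simp add: matrix_matrix_mult_def q sum.cartesian_product case_prod_unfold)
  also have "\<dots> = (\<Sum>k\<in>UNIV. \<Sum>l\<in>UNIV. \<Sum>X\<in>B. \<Sum>Y\<in>B.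
      (cnj (X $ g $ k) * cnj (Y $ k $ g')) * (\<phi> X $ h $ l * \<phi> Y $ l $ h'))"
    by (simp add: choi_nth sum_product mult.assoc mult.left_commute)
  also have "\<dots> = (\<Sum>X\<in>B. \<Sum>Y\<in>B. \<Sum>k\<in>UNIV. \<Sum>l\<in>UNIV.
      (cnj (X $ g $ k) * cnj (Y $ k $ g')) * (\<phi> X $ h $ l * \<phi> Y $ l $ h'))"
    by (rule sum_swap_pairs)
  also have "\<dots> = (\<Sum>X\<in>B. \<Sum>Y\<in>B. cnj ((X ** Y) $ g $ g') * \<phi> (X ** Y) $ h $ h')"
    by (simp add: \<phi>_mult BA) (simp add: matrix_matrix_mult_def sum_product)
  also have "\<dots> = (\<Sum>X\<in>B. \<Sum>Y\<in>B. cnj ((X ** (ctranspose X ** Y)) $ g $ g') * \<phi> Y $ h $ h')"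
  proof (rule sum.cong)
    fix X assume "X \<in> B"
    show "(\<Sum>Y\<in>B. cnj ((X ** Y) $ g $ g') * \<phi> (X ** Y) $ h $ h')
       = (\<Sum>Y\<in>B. cnj ((X ** (ctranspose X ** Y)) $ g $ g') * \<phi> Y $ h $ h')"
    proof (rule frame_exchange)
      fix Y Z :: "complex^'g^'g"
      have "hs (X ** Y) Z = hs Y (ctranspose X ** Z)"
        by (rule hs_matrix_mult)
      moreover have "c *\<^sub>m (X ** Y) = X ** (c *\<^sub>m Y)" for c
        by (simp add: vec_eq_iff matrix_matrix_mult_def sum_distrib_left mult_ac)
      ultimately show "hs (X ** Y) Z *\<^sub>m (X ** Y) = X ** (hs Y (ctranspose X ** Z) *\<^sub>m Y)"
        by simp
    next
      show "X ** (\<Sum>Y\<in>B. f Y) = (\<Sum>Y\<in>B. X ** f Y)"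
        for f :: "complex^'g^'g \<Rightarrow> complex^'g^'g"
        unfolding vec_eq_iff
        by (simp add: matrix_matrix_mult_def sum_distrib_left) (intro allI, rule sum.swap)
    qed (use \<open>X \<in> B\<close> in \<open>auto simp: BA mult_closed star_closed\<close>)
  qed simp
  also have "\<dots> = (\<Sum>X\<in>B. \<Sum>Y\<in>B. \<Sum>k\<in>UNIV. cnj ((X ** ctranspose X) $ g $ k) * (cnj (Y $ k $ g') * \<phi> Y $ h $ h'))"
    by (simp add: matrix_mul_assoc) (simp add: matrix_matrix_mult_def[of "_ ** _"] sum_distrib_right mult.assoc)
  also have "\<dots> = (\<Sum>X\<in>B. \<Sum>k\<in>UNIV. cnj ((X ** ctranspose X) $ g $ k) * choi $ (k, h) $ q)"
    by (subst sum.swap) (simp add: q choi_nth sum_distrib_left)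
  also have "\<dots> = (\<Sum>k\<in>UNIV. cnj ((\<Sum>X\<in>B. X ** ctranspose X) $ g $ k) * choi $ (k, h) $ q)"
    by (subst sum.swap) (simp add: sum_distrib_right)
  finally show ?thesis .
qed

lemma choi_psd: "psd choi"
proof (rule ccontr)
  assume "\<not> psd choi"
  with choi_hermitian obtain v \<mu> where v: "v \<noteq> 0" "\<mu> < 0" "choi *v v = complex_of_real \<mu> *s v"
    by (rule hermitian_not_psd_eigenvector)
  have norm_sq: "complex_of_real ((cmod z)\<^sup>2) = cnj z * z" for z
    using complex_norm_square[of z] by (simp add: mult.commute)
  define C where "C = (\<Sum>X\<in>B. X ** ctranspose X)"
  \<comment> \<open>Apply \<open>choi\<close> twice to \<open>v\<close>, once through the eigenvalue
    equation and once through \<open>choi_square\<close>, then cancel one factor \<mu>, which is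
    nonzero.\<close>
  have ev: "(\<Sum>k\<in>UNIV. cnj (C $ g $ k) * v $ (k, h)) = of_real \<mu> * v $ (g, h)" for g h
  proof -
    have "of_real \<mu> * (of_real \<mu> * v $ (g, h)) = (choi *v (choi *v v)) $ (g, h)"
      by (simp add: v(3) vector_scalar_commute)
    also have "\<dots> = ((choi ** choi) *v v) $ (g, h)"
      by (simp add: matrix_vector_mul_assoc)
    also have "\<dots> = (\<Sum>q\<in>UNIV. \<Sum>k\<in>UNIV. cnj (C $ g $ k) * (choi $ (k, h) $ q * v $ q))"
      by (simp add: matrix_vector_mult_def choi_square C_def sum_distrib_right mult.assoc)
    also have "\<dots> = (\<Sum>k\<in>UNIV. cnj (C $ g $ k) * (choi *v v) $ (k, h))"
      by (subst sum.swap) (simp add: matrix_vector_mult_def sum_distrib_left)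
    also have "\<dots> = of_real \<mu> * (\<Sum>k\<in>UNIV. cnj (C $ g $ k) * v $ (k, h))"
      by (simp add: v(3) sum_distrib_left mult_ac)
    finally show ?thesis using \<open>\<mu> < 0\<close> by simp
  qed
  \<comment> \<open>Pairing \<open>ev\<close> with \<open>v\<close> gives a negative number on the
    left, while the factorisation of \<open>C\<close> makes the right side a sum of squared
    moduli.\<close>
  have "of_real (\<mu> * (norm v)\<^sup>2)
      = (\<Sum>g\<in>UNIV. \<Sum>h\<in>UNIV. cnj (v $ (g, h)) * (of_real \<mu> * v $ (g, h)))"
    by (simp add: cdot_self[symmetric] cdot_def sum.cartesian_product case_prod_unfold
        sum_distrib_left mult_ac del: of_real_power)
  also have "\<dots> = (\<Sum>g\<in>UNIV. \<Sum>h\<in>UNIV. \<Sum>k\<in>UNIV. cnj (C $ g $ k) * (cnj (v $ (g, h)) * v $ (k, h)))"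
    unfolding ev[symmetric] sum_distrib_left by (simp add: mult_ac)
  also have "\<dots> = (\<Sum>g\<in>UNIV. \<Sum>h\<in>UNIV. \<Sum>k\<in>UNIV. \<Sum>X\<in>B. \<Sum>l\<in>UNIV.
      cnj (X $ g $ l * v $ (g, h)) * (X $ k $ l * v $ (k, h)))"
    by (simp add: C_def matrix_matrix_mult_def sum_distrib_left sum_distrib_right mult_ac)
  also have "\<dots> = (\<Sum>g\<in>UNIV. \<Sum>h\<in>UNIV. \<Sum>X\<in>B. \<Sum>l\<in>UNIV. \<Sum>k\<in>UNIV.
      cnj (X $ g $ l * v $ (g, h)) * (X $ k $ l * v $ (k, h)))"
    by (rule sum.cong[OF refl], rule sum.cong[OF refl], subst sum.swap,
        rule sum.cong[OF refl], rule sum.swap)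
  also have "\<dots> = (\<Sum>X\<in>B. \<Sum>l\<in>UNIV. \<Sum>h\<in>UNIV. \<Sum>g\<in>UNIV. \<Sum>k\<in>UNIV.
      cnj (X $ g $ l * v $ (g, h)) * (X $ k $ l * v $ (k, h)))"
    by (subst sum_swap_pairs, intro sum.cong refl, rule sum.swap)
  also have "\<dots> = (\<Sum>X\<in>B. \<Sum>l\<in>UNIV. \<Sum>h\<in>UNIV. of_real ((cmod (\<Sum>k\<in>UNIV. X $ k $ l * v $ (k, h)))\<^sup>2))"
    unfolding norm_sq cnj_sum sum_product ..
  finally have "\<mu> * (norm v)\<^sup>2 = (\<Sum>X\<in>B. \<Sum>l\<in>UNIV. \<Sum>h\<in>UNIV. (cmod (\<Sum>k\<in>UNIV. X $ k $ l * v $ (k, h)))\<^sup>2)"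
    unfolding of_real_sum[symmetric] of_real_eq_iff .
  also have "\<dots> \<ge> 0" by (intro sum_nonneg) simp
  finally show False
    using v by (simp add: zero_le_mult_iff)
qed

end

subsection \<open>The map with a given Choi matrix\<close>

definition transfer :: "complex^('g::finite \<times> 'h::finite)^('g \<times> 'h) \<Rightarrow> complex^'g^'g \<Rightarrow> complex^'h^'h" where
  "transfer M X = (\<chi> h h'. \<Sum>g\<in>UNIV. \<Sum>g'\<in>UNIV. M $ (g, h) $ (g', h') * X $ g $ g')"

text \<open>The conjugation makes \<open>transfer (swap_roles M)\<close> the adjoint of
  \<open>transfer M\<close> for \<open>hs\<close>.\<close>

definition swap_roles :: "complex^('g::finite \<times> 'h::finite)^('g \<times> 'h) \<Rightarrow> complex^('h \<times> 'g)^('h \<times> 'g)" where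
  "swap_roles M = (\<chi> p q. cnj (M $ prod.swap p $ prod.swap q))"

lemma transfer_nth:
  "transfer M X $ h $ h' = (\<Sum>g\<in>UNIV. \<Sum>g'\<in>UNIV. M $ (g, h) $ (g', h') * X $ g $ g')"
  by (simp add: transfer_def)

lemma swap_roles_nth [simp]: "swap_roles M $ (h, g) $ (h', g') = cnj (M $ (g, h) $ (g', h'))"
  by (simp add: swap_roles_def)

lemma swap_roles_swap_roles [simp]: "swap_roles (swap_roles M) = M"
  by (simp add: vec_eq_iff)

lemma transfer_0: "transfer M 0 = 0"
  by (simp add: vec_eq_iff transfer_nth)

lemma transfer_add: "transfer M (X + Y) = transfer M X + transfer M Y"
  by (simp add: vec_eq_iff transfer_nth algebra_simps sum.distrib)

lemma transfer_scale: "transfer M (c *\<^sub>m X) = c *\<^sub>m transfer M X"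
  by (simp add: vec_eq_iff transfer_nth sum_distrib_left mult_ac)

lemma hs_transfer: "hs (transfer M X) Y = hs X (transfer (swap_roles M) Y)"
proof -
  have "hs (transfer M X) Y = (\<Sum>h\<in>UNIV. \<Sum>h'\<in>UNIV. \<Sum>g\<in>UNIV. \<Sum>g'\<in>UNIV.
      cnj (M $ (g, h) $ (g', h')) * cnj (X $ g $ g') * Y $ h $ h')"
    by (simp add: hs_def transfer_nth sum_distrib_right)
  also have "\<dots> = (\<Sum>g\<in>UNIV. \<Sum>g'\<in>UNIV. \<Sum>h\<in>UNIV. \<Sum>h'\<in>UNIV.
      cnj (M $ (g, h) $ (g', h')) * cnj (X $ g $ g') * Y $ h $ h')"
    by (rule sum_swap_pairs)
  also have "\<dots> = hs X (transfer (swap_roles M) Y)"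
    by (simp add: hs_def transfer_nth sum_distrib_left mult_ac)
  finally show ?thesis .
qed

section \<open>Matrices witnessing the isomorphism and the maps they induce\<close>

locale psd_isomorphism =
  fixes G :: "'g::finite \<Rightarrow> 'g \<Rightarrow> bool" and H :: "'h::finite \<Rightarrow> 'h \<Rightarrow> bool"
    and M :: "complex^('g \<times> 'h)^('g \<times> 'h)"
  assumes psd: "psd M"
    and sum_H: "\<And>g g'. (\<Sum>h\<in>UNIV. \<Sum>h'\<in>UNIV. M $ (g, h) $ (g', h')) = 1"
    and sum_G: "\<And>h h'. (\<Sum>g\<in>UNIV. \<Sum>g'\<in>UNIV. M $ (g, h) $ (g', h')) = 1"
    and rel: "\<And>g h g' h'. rel G g g' \<noteq> rel H h h' \<Longrightarrow> M $ (g, h) $ (g', h') = 0"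
    and irrefl: "irreflp G" "irreflp H"
begin

text \<open>All conditions on \<open>M\<close> are symmetric in the two graphs. Every fact about
  \<open>transfer M\<close> proved in this locale thus has a dual about its adjoint.\<close>

lemma swapped: "psd_isomorphism H G (swap_roles M)"
proof
  have herm: "hermitian M" and pos: "\<And>v. cdot v (M *v v) \<in> \<real>\<^sub>\<ge>\<^sub>0"
    using psd by (auto simp: psd_iff_cdot)
  have "hermitian (swap_roles M)"
    using hermitianD[OF herm] by (simp add: hermitian_def vec_eq_iff)
  moreover have "cdot v (swap_roles M *v v) \<in> \<real>\<^sub>\<ge>\<^sub>0" for v
  proof -
    have swap: "(\<Sum>p\<in>UNIV. f p) = (\<Sum>p\<in>UNIV. f (prod.swap p))" for f :: "'h \<times> 'g \<Rightarrow> complex"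
      by (rule sum.reindex_bij_witness[of _ prod.swap prod.swap]) auto
    \<comment> \<open>Conjugating \<open>v\<close> and exchanging its indices carries the form of
      \<open>swap_roles M\<close> at \<open>v\<close> to the conjugate of the form of
      \<open>M\<close> at \<open>w\<close>.\<close>
    define w where "w = (\<chi> p. cnj (v $ prod.swap p))"
    have "cdot v (swap_roles M *v v) = cnj (cdot w (M *v w))"
    proof -
      have "(swap_roles M *v v) $ prod.swap p = cnj ((M *v w) $ p)" for p
        by (simp add: matrix_vector_mult_def w_def swap[of "\<lambda>q. swap_roles M $ _ $ q * _ q"])
           (simp add: swap_roles_def)
      then show ?thesis
        unfolding cdot_def swap[of "\<lambda>p. cnj (v $ p) * _ p"] by (simp add: w_def)
    qed
    then show ?thesis
      using pos[of w] by (simp add: complex_nonneg_Reals_iff)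
  qed
  ultimately show "psd (swap_roles M)" by (simp add: psd_iff_cdot)
  show "(\<Sum>g\<in>UNIV. \<Sum>g'\<in>UNIV. swap_roles M $ (h, g) $ (h', g')) = 1" for h h'
    using sum_G[of h h'] by (simp flip: cnj_sum)
  show "(\<Sum>h\<in>UNIV. \<Sum>h'\<in>UNIV. swap_roles M $ (h, g) $ (h', g')) = 1" for g g'
    using sum_H[of g g'] by (simp flip: cnj_sum)
  show "swap_roles M $ (h, g) $ (h', g') = 0" if "rel H h h' \<noteq> rel G g g'" for h g h' g'
    using that rel[of g g' h h'] by simp
qed (use irrefl in auto)

lemma transfer_all_ones: "transfer M all_ones = all_ones"
  by (simp add: vec_eq_iff transfer_nth sum_G)

lemma transfer_star: "transfer M (ctranspose X) = ctranspose (transfer M X)"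
proof -
  have "hermitian M" using psd by (simp add: psd_def)
  then have "transfer M (ctranspose X) $ h $ h' = ctranspose (transfer M X) $ h $ h'" for h h'
    by (simp add: transfer_nth hermitianD) (rule sum.swap)
  then show ?thesis by (simp add: vec_eq_iff)
qed

text \<open>Since \<open>rel\<close> tests equality before adjacency, reading adjacency off it uses
  that the graphs have no loops.\<close>

lemma rel_eq_if_nonzero:
  assumes "M $ (g, h) $ (g', h') \<noteq> 0"
  shows "g = g' \<longleftrightarrow> h = h'" and "G g g' \<longleftrightarrow> H h h'"
proof -
  have "rel G g g' = rel H h h'" using assms rel by blast
  then show "g = g' \<longleftrightarrow> h = h'" "G g g' \<longleftrightarrow> H h h'"
    using irrefl by (auto simp: rel_def irreflp_def split: if_splits)
qed

text \<open>On the support of \<open>M\<close> the factor \<open>P $ g $ g'\<close> equals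
  \<open>Q $ h $ h'\<close>, which is constant in the summation and leaves the sum.\<close>

lemma transfer_schur:
  assumes "\<And>g g' h h'. M $ (g, h) $ (g', h') \<noteq> 0 \<Longrightarrow> P $ g $ g' = Q $ h $ h'"
  shows "transfer M (P \<odot> X) = Q \<odot> transfer M X"
proof -
  have "M $ (g, h) $ (g', h') * (P $ g $ g' * X $ g $ g') = Q $ h $ h' * (M $ (g, h) $ (g', h') * X $ g $ g')"
    for g h g' h'
    using assms[of g h g' h'] by (cases "M $ (g, h) $ (g', h') = 0") auto
  note key = this
  show ?thesis
    by (simp add: vec_eq_iff transfer_nth sum_distrib_left key)
qed

lemma transfer_schur_one: "transfer M (mat 1 \<odot> X) = mat 1 \<odot> transfer M X"
  and transfer_schur_adj: "transfer M (adj_matrix G \<odot> X) = adj_matrix H \<odot> transfer M X"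
  by (rule transfer_schur; simp add: mat_nth rel_eq_if_nonzero)+

text \<open>The identity is its Schur product with \<open>all_ones\<close>, which
  \<open>transfer M\<close> preserves; the adjacency matrix is treated in the same way.\<close>

lemma transfer_one: "transfer M (mat 1) = mat 1"
  using transfer_schur_one[of 1] by (simp add: transfer_all_ones)

lemma transfer_adj: "transfer M (adj_matrix G) = adj_matrix H"
  using transfer_schur_adj[of 1] by (simp add: transfer_all_ones)

text \<open>The partial trace of \<open>M\<close> over the first factor is the identity because
  \<open>transfer M\<close> is unital. Unitality of the adjoint gives the other partial
  trace.\<close>

lemma sum_diag_G: "(\<Sum>g\<in>UNIV. M $ (g, h) $ (g, h')) = (if h = h' then 1 else 0)"
  using transfer_one by (simp add: vec_eq_iff transfer_nth mat_nth if_distrib cong: if_cong)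

lemma sum_diag_H: "(\<Sum>h\<in>UNIV. M $ (g, h) $ (g', h)) = (if g = g' then 1 else 0)"
  using arg_cong[OF psd_isomorphism.sum_diag_G[OF swapped, of g g'], of cnj]
  by (simp split: if_splits)

section \<open>Pairs matched by the map and its adjoint\<close>

text \<open>Requiring the adjoint to lead back from \<open>Y\<close> to \<open>X\<close> forces the
  Hilbert-Schmidt norms of \<open>X\<close> and \<open>Y\<close> to agree, which yields the
  intertwining relation below.\<close>

definition linked :: "complex^'g^'g \<Rightarrow> complex^'h^'h \<Rightarrow> bool" where
  "linked X Y \<longleftrightarrow> transfer M X = Y \<and> transfer (swap_roles M) Y = X"

text \<open>With a Kraus decomposition \<open>M = \<Sum>\<^sub>k vec(K\<^sub>k) vec(K\<^sub>k)\<^sup>*\<close> the equation says \<open>X K\<^sub>k\<^sup>* = K\<^sub>k\<^sup>* Y\<close> for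
  all \<open>k\<close>.\<close>

lemma linked_intertwines:
  assumes "linked X Y"
  shows "(\<Sum>g'\<in>UNIV. M $ p $ (g', h) * X $ g $ g') = (\<Sum>h'\<in>UNIV. M $ p $ (g, h') * Y $ h' $ h)"
proof -
  have herm: "hermitian M" using psd by (simp add: psd_def)
  \<comment> \<open>This evaluates a functional \<open>K\<close> on a vector supported on the
    positions with \<open>snd q = h\<close> and those with \<open>fst q = g\<close>; at
    \<open>(g, h)\<close> both parts contribute.\<close>
  have select: "(\<Sum>q\<in>UNIV. K q * ((if snd q = h then x (fst q) else 0) - (if fst q = g then y (snd q) else 0)))
    = (\<Sum>a\<in>UNIV. K (a, h) * x a) - (\<Sum>b\<in>UNIV. K (g, b) * y b)"
    for K :: "'g \<times> 'h \<Rightarrow> complex" and g h x y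
  proof -
    have "(\<Sum>q\<in>UNIV. K q * ((if snd q = h then x (fst q) else 0) - (if fst q = g then y (snd q) else 0)))
      = (\<Sum>a\<in>UNIV. \<Sum>b\<in>UNIV. (if b = h then K (a, b) * x a else 0) - (if a = g then K (a, b) * y b else 0))"
      unfolding sum.cartesian_product UNIV_Times_UNIV
      by (rule sum.cong) (auto simp: algebra_simps)
    also have "\<dots> = (\<Sum>a\<in>UNIV. K (a, h) * x a) - (\<Sum>b\<in>UNIV. K (g, b) * y b)"
      by (simp add: sum_subtractf) (subst sum.swap, simp)
    finally show ?thesis .
  qed
  \<comment> \<open>The vector \<open>t g h\<close> is chosen so that \<open>M *v t g h\<close>
    lists, over all \<open>p\<close>, the difference of the two sides of the claim.\<close>
  define t :: "'g \<Rightarrow> 'h \<Rightarrow> complex^('g \<times> 'h)" where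
    "t g h = (\<chi> q. (if snd q = h then X $ g $ fst q else 0) - (if fst q = g then Y $ snd q $ h else 0))"
    for g h
  have Mt: "(M *v t g h) $ p
      = (\<Sum>a\<in>UNIV. M $ p $ (a, h) * X $ g $ a) - (\<Sum>b\<in>UNIV. M $ p $ (g, b) * Y $ b $ h)" for g h p
    using select[of "\<lambda>q. M $ p $ q" h "\<lambda>a. X $ g $ a" g "\<lambda>b. Y $ b $ h"]
    by (simp add: matrix_vector_mult_def t_def)
  have cdot_t: "cdot (t g h) w
      = (\<Sum>a\<in>UNIV. w $ (a, h) * cnj (X $ g $ a)) - (\<Sum>b\<in>UNIV. w $ (g, b) * cnj (Y $ b $ h))" for g h w
    using select[of "\<lambda>q. w $ q" h "\<lambda>a. cnj (X $ g $ a)" g "\<lambda>b. cnj (Y $ b $ h)"]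
    by (simp add: cdot_def t_def mult.commute if_distrib[of cnj] cong: if_cong)
  \<comment> \<open>The form at \<open>t g h\<close> splits into a term in \<open>X\<close> alone,
    two mixed terms and a term in \<open>Y\<close> alone. Summed over \<open>g\<close> and
    \<open>h\<close>, the outer ones reduce by the partial traces and the mixed ones by
    \<open>transfer M X = Y\<close>.\<close>
  have tMt: "cdot (t g h) (M *v t g h)
     = (\<Sum>a\<in>UNIV. \<Sum>a'\<in>UNIV. M $ (a, h) $ (a', h) * (cnj (X $ g $ a) * X $ g $ a'))
     - (\<Sum>a\<in>UNIV. \<Sum>b\<in>UNIV. Y $ b $ h * cnj (M $ (g, b) $ (a, h) * X $ g $ a))
     - (\<Sum>a\<in>UNIV. \<Sum>b\<in>UNIV. cnj (Y $ b $ h) * (M $ (g, b) $ (a, h) * X $ g $ a))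
     + (\<Sum>b\<in>UNIV. \<Sum>b'\<in>UNIV. M $ (g, b) $ (g, b') * (cnj (Y $ b $ h) * Y $ b' $ h))" for g h
  proof -
    have "(\<Sum>b\<in>UNIV. \<Sum>a\<in>UNIV. cnj (Y $ b $ h) * (M $ (g, b) $ (a, h) * X $ g $ a))
        = (\<Sum>a\<in>UNIV. \<Sum>b\<in>UNIV. cnj (Y $ b $ h) * (M $ (g, b) $ (a, h) * X $ g $ a))"
      by (rule sum.swap)
    then show ?thesis
      unfolding cdot_t Mt left_diff_distrib sum_distrib_right sum_subtractf
      by (simp add: hermitianD[OF herm] mult_ac)
  qed
  have T1: "(\<Sum>g\<in>UNIV. \<Sum>h\<in>UNIV. \<Sum>a\<in>UNIV. \<Sum>a'\<in>UNIV.
      M $ (a, h) $ (a', h) * (cnj (X $ g $ a) * X $ g $ a')) = hs X X"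
  proof -
    have "(\<Sum>g\<in>UNIV. \<Sum>h\<in>UNIV. \<Sum>a\<in>UNIV. \<Sum>a'\<in>UNIV.
        M $ (a, h) $ (a', h) * (cnj (X $ g $ a) * X $ g $ a'))
      = (\<Sum>a\<in>UNIV. \<Sum>a'\<in>UNIV. \<Sum>g\<in>UNIV. \<Sum>h\<in>UNIV.
        M $ (a, h) $ (a', h) * (cnj (X $ g $ a) * X $ g $ a'))"
      by (rule sum_swap_pairs)
    also have "\<dots> = (\<Sum>a\<in>UNIV. \<Sum>a'\<in>UNIV. \<Sum>g\<in>UNIV.
        (if a = a' then cnj (X $ g $ a) * X $ g $ a' else 0))"
      unfolding sum_distrib_right[symmetric] sum_diag_H by (intro sum.cong refl) simp
    also have "\<dots> = (\<Sum>a\<in>UNIV. \<Sum>g\<in>UNIV. cnj (X $ g $ a) * X $ g $ a)"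
      by (rule sum.cong[OF refl], subst sum.swap) simp
    also have "\<dots> = hs X X"
      unfolding hs_def by (rule sum.swap)
    finally show ?thesis .
  qed
  have T4: "(\<Sum>g\<in>UNIV. \<Sum>h\<in>UNIV. \<Sum>b\<in>UNIV. \<Sum>b'\<in>UNIV.
      M $ (g, b) $ (g, b') * (cnj (Y $ b $ h) * Y $ b' $ h)) = hs Y Y"
  proof -
    have "(\<Sum>g\<in>UNIV. \<Sum>h\<in>UNIV. \<Sum>b\<in>UNIV. \<Sum>b'\<in>UNIV.
        M $ (g, b) $ (g, b') * (cnj (Y $ b $ h) * Y $ b' $ h))
      = (\<Sum>b\<in>UNIV. \<Sum>b'\<in>UNIV. \<Sum>g\<in>UNIV. \<Sum>h\<in>UNIV.
        M $ (g, b) $ (g, b') * (cnj (Y $ b $ h) * Y $ b' $ h))"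
      by (rule sum_swap_pairs)
    also have "\<dots> = (\<Sum>b\<in>UNIV. \<Sum>b'\<in>UNIV. \<Sum>h\<in>UNIV.
        (if b = b' then cnj (Y $ b $ h) * Y $ b' $ h else 0))"
      unfolding sum_distrib_right[symmetric] sum_distrib_left[symmetric] sum_diag_G
      by (intro sum.cong refl) simp
    also have "\<dots> = (\<Sum>b\<in>UNIV. \<Sum>h\<in>UNIV. cnj (Y $ b $ h) * Y $ b $ h)"
      by (rule sum.cong[OF refl], subst sum.swap) simp
    finally show ?thesis by (simp add: hs_def)
  qed
  have cross: "(\<Sum>g\<in>UNIV. \<Sum>h\<in>UNIV. \<Sum>a\<in>UNIV. \<Sum>b\<in>UNIV. F b h * E g a b h)
      = (\<Sum>b\<in>UNIV. \<Sum>h\<in>UNIV. F b h * (\<Sum>g\<in>UNIV. \<Sum>a\<in>UNIV. E g a b h))"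
    for F :: "'h \<Rightarrow> 'h \<Rightarrow> complex" and E :: "'g \<Rightarrow> 'g \<Rightarrow> 'h \<Rightarrow> 'h \<Rightarrow> complex"
  proof -
    have "(\<Sum>g\<in>UNIV. \<Sum>h\<in>UNIV. \<Sum>a\<in>UNIV. \<Sum>b\<in>UNIV. F b h * E g a b h)
        = (\<Sum>g\<in>UNIV. \<Sum>a\<in>UNIV. \<Sum>b\<in>UNIV. \<Sum>h\<in>UNIV. F b h * E g a b h)"
      by (rule sum.cong[OF refl], subst sum.swap, rule sum.cong[OF refl], rule sum.swap)
    also have "\<dots> = (\<Sum>b\<in>UNIV. \<Sum>h\<in>UNIV. \<Sum>g\<in>UNIV. \<Sum>a\<in>UNIV. F b h * E g a b h)"
      by (rule sum_swap_pairs)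
    finally show ?thesis by (simp add: sum_distrib_left)
  qed
  have T2: "(\<Sum>g\<in>UNIV. \<Sum>h\<in>UNIV. \<Sum>a\<in>UNIV. \<Sum>b\<in>UNIV.
      Y $ b $ h * cnj (M $ (g, b) $ (a, h) * X $ g $ a)) = hs (transfer M X) Y"
    unfolding cross by (simp add: hs_def transfer_nth mult.commute)
  have T3: "(\<Sum>g\<in>UNIV. \<Sum>h\<in>UNIV. \<Sum>a\<in>UNIV. \<Sum>b\<in>UNIV.
      cnj (Y $ b $ h) * (M $ (g, b) $ (a, h) * X $ g $ a)) = hs Y (transfer M X)"
    unfolding cross by (simp add: hs_def transfer_nth)
  have Y: "transfer M X = Y" and X: "transfer (swap_roles M) Y = X"
    using assms by (auto simp: linked_def)
  have "hs X X = hs Y Y"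
    using hs_transfer[of M X Y] by (simp add: X Y)
  \<comment> \<open>The four totals are \<open>hs X X\<close>, twice \<open>hs Y Y\<close>
    subtracted, and \<open>hs Y Y\<close> added, so they cancel. As every summand is nonnegative,
    each vanishes, and \<open>M\<close> kills each \<open>t g h\<close>.\<close>
  then have zero: "(\<Sum>g\<in>UNIV. \<Sum>h\<in>UNIV. cdot (t g h) (M *v t g h)) = 0"
    by (simp only: tMt sum.distrib sum_subtractf T1 T2 T3 T4 Y) simp
  have pos: "cdot (t g h) (M *v t g h) = of_real (Re (cdot (t g h) (M *v t g h)))"
      "0 \<le> Re (cdot (t g h) (M *v t g h))" for g h
    using psd unfolding psd_iff_cdot by (auto simp: complex_nonneg_Reals_iff complex_eq_iff)
  have "(\<Sum>g\<in>UNIV. \<Sum>h\<in>UNIV. Re (cdot (t g h) (M *v t g h))) = 0"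
    using arg_cong[OF zero, of Re] by simp
  then have "Re (cdot (t g h) (M *v t g h)) = 0"
    using pos(2) by (simp add: sum_nonneg_eq_0_iff sum_nonneg)
  then have "M *v t g h = 0"
    using psd_cdot_eq_0[OF psd] pos(1) by (metis of_real_0)
  then show ?thesis
    using Mt[of g h p] by simp
qed

lemma linked_swap: "psd_isomorphism.linked (swap_roles M) Y X \<longleftrightarrow> linked X Y"
  unfolding linked_def psd_isomorphism.linked_def[OF swapped] by auto

text \<open>By \<open>linked_intertwines\<close>, the factor \<open>X'\<close> under
  \<open>M\<close> can be replaced by \<open>Y'\<close>, which leaves the sum on the right and
  leaves \<open>transfer M X\<close> on the left.\<close>

lemma transfer_mult:
  assumes "linked X Y" "linked X' Y'"
  shows "transfer M (X ** X') = Y ** Y'"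
proof -
  have "transfer M (X ** X') $ h $ h' = (Y ** Y') $ h $ h'" for h h'
  proof -
    have "transfer M (X ** X') $ h $ h'
      = (\<Sum>g\<in>UNIV. \<Sum>g'\<in>UNIV. \<Sum>a\<in>UNIV. M $ (g, h) $ (g', h') * (X $ g $ a * X' $ a $ g'))"
      by (simp add: transfer_nth matrix_matrix_mult_def sum_distrib_left)
    also have "\<dots> = (\<Sum>g\<in>UNIV. \<Sum>a\<in>UNIV. X $ g $ a * (\<Sum>g'\<in>UNIV. M $ (g, h) $ (g', h') * X' $ a $ g'))"
      by (rule sum.cong[OF refl], subst sum.swap) (simp add: sum_distrib_left mult_ac)
    also have "\<dots> = (\<Sum>g\<in>UNIV. \<Sum>a\<in>UNIV. \<Sum>b\<in>UNIV. M $ (g, h) $ (a, b) * X $ g $ a * Y' $ b $ h')"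
      unfolding linked_intertwines[OF assms(2)] by (simp add: sum_distrib_left mult_ac)
    also have "\<dots> = (\<Sum>g\<in>UNIV. \<Sum>b\<in>UNIV. \<Sum>a\<in>UNIV. M $ (g, h) $ (a, b) * X $ g $ a * Y' $ b $ h')"
      by (rule sum.cong[OF refl], rule sum.swap)
    also have "\<dots> = (\<Sum>b\<in>UNIV. \<Sum>g\<in>UNIV. \<Sum>a\<in>UNIV. M $ (g, h) $ (a, b) * X $ g $ a * Y' $ b $ h')"
      by (rule sum.swap)
    also have "\<dots> = (\<Sum>b\<in>UNIV. transfer M X $ h $ b * Y' $ b $ h')"
      by (simp add: transfer_nth sum_distrib_right)
    finally show ?thesis
      using assms(1) by (simp add: matrix_matrix_mult_def linked_def)
  qed
  then show ?thesis by (simp add: vec_eq_iff)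
qed

lemma linked_mult:
  assumes "linked X Y" "linked X' Y'"
  shows "linked (X ** X') (Y ** Y')"
  using transfer_mult[OF assms]
    psd_isomorphism.transfer_mult[OF swapped, of Y X Y' X'] assms
  by (simp add: linked_swap) (simp add: linked_def)

lemma linked_star: "linked X Y \<Longrightarrow> linked (ctranspose X) (ctranspose Y)"
  by (auto simp: linked_def transfer_star psd_isomorphism.transfer_star[OF swapped])

lemma linked_schur:
  assumes "linked X Y"
  shows "linked (mat 1 \<odot> X) (mat 1 \<odot> Y)" "linked (adj_matrix G \<odot> X) (adj_matrix H \<odot> Y)"
  using assms unfolding linked_def
  by (auto simp: transfer_schur_one transfer_schur_adj psd_isomorphism.transfer_schur_one[OF swapped]
      psd_isomorphism.transfer_schur_adj[OF swapped])

lemma linked_basic: "linked (mat 1) (mat 1)" "linked 1 1" "linked (adj_matrix G) (adj_matrix H)"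
  unfolding linked_def
  by (simp_all add: transfer_one transfer_all_ones transfer_adj psd_isomorphism.transfer_one[OF swapped]
      psd_isomorphism.transfer_all_ones[OF swapped] psd_isomorphism.transfer_adj[OF swapped])

text \<open>The closure properties of linked pairs are componentwise, so they pass to the first
  components as long as the second ones stay in \<open>S\<close>.\<close>

lemma partially_coherent_linked:
  assumes "partially_coherent H S"
  shows "partially_coherent G {X. \<exists>Y\<in>S. linked X Y}"
proof -
  note S = assms[unfolded partially_coherent_def cmat.subspace_def]
  have "linked 0 0" by (simp add: linked_def transfer_0)
  moreover have "linked (X + X') (Y + Y')" if "linked X Y" "linked X' Y'" for X X' Y Y'
    using that by (auto simp: linked_def transfer_add)
  moreover have "linked (c *\<^sub>m X) (c *\<^sub>m Y)" if "linked X Y" for c X Y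
    using that by (auto simp: linked_def transfer_scale)
  ultimately have "cmat.subspace {X. \<exists>Y\<in>S. linked X Y}"
    using S unfolding cmat.subspace_def by blast
  moreover have "P \<odot> X \<in> {X. \<exists>Y\<in>S. linked X Y}"
    if "P \<in> {mat 1, adj_matrix G}" "X \<in> {X. \<exists>Y\<in>S. linked X Y}" for P X
    using that S linked_schur by blast
  ultimately show ?thesis
    unfolding partially_coherent_def using S linked_mult linked_star linked_basic
    by (intro conjI ballI) blast+
qed

end

subsection \<open>The partially coherent algebra\<close>

lemma partially_coherent_algebra: "partially_coherent G (partially_coherent_algebra G)"
proof -
  have sub: "cmat.subspace (\<Inter> {S. partially_coherent G S})"
    by (intro cmat.subspace_Inter) (auto simp: partially_coherent_def)
  show ?thesis
    unfolding partially_coherent_algebra_def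
    by (subst partially_coherent_def, intro conjI, rule sub) (auto simp: partially_coherent_def)
qed

lemma partially_coherent_algebra_least:
  "partially_coherent G S \<Longrightarrow> partially_coherent_algebra G \<subseteq> S"
  by (auto simp: partially_coherent_algebra_def)

context psd_isomorphism
begin

text \<open>Both conclusions follow from minimality of the algebra of \<open>G\<close>: it lies in
  the partially coherent space of matrices linked to a member of the algebra of
  \<open>H\<close>.\<close>

lemma transfer_algebra:
  assumes "X \<in> partially_coherent_algebra G"
  shows "linked X (transfer M X)" "transfer M X \<in> partially_coherent_algebra H"
  using partially_coherent_algebra_least[OF partially_coherent_linked[OF partially_coherent_algebra]] assms
  by (auto simp: linked_def)

text \<open>The adjoint is the inverse on the algebras, because their members are linked to their
  images.\<close>

lemma bij_betw_transfer:
  "bij_betw (transfer M) (partially_coherent_algebra G) (partially_coherent_algebra H)"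
proof (rule bij_betw_byWitness[where f' = "transfer (swap_roles M)"])
  note swap = psd_isomorphism.transfer_algebra[OF swapped]
  show "\<forall>X\<in>partially_coherent_algebra G. transfer (swap_roles M) (transfer M X) = X"
    using transfer_algebra by (auto simp: linked_def)
  show "\<forall>Y\<in>partially_coherent_algebra H. transfer M (transfer (swap_roles M) Y) = Y"
    using swap by (auto simp: linked_swap linked_def)
  show "transfer M ` partially_coherent_algebra G \<subseteq> partially_coherent_algebra H"
    using transfer_algebra by blast
  show "transfer (swap_roles M) ` partially_coherent_algebra H \<subseteq> partially_coherent_algebra G"
    using swap by blast
qed

end

section \<open>From algebra isomorphisms to witnessing matrices and back\<close>

text \<open>This expresses the sum of the entries of a matrix through algebra operations, so that a
  homomorphism fixing \<open>all_ones\<close> must preserve it.\<close>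

lemma all_ones_conjugation:
  fixes X :: "complex^'n^'n"
  shows "(1 :: complex^'n^'n) ** X ** (1 :: complex^'n^'n) = hs 1 X *\<^sub>m 1"
proof -
  have "((1 :: complex^'n^'n) ** X ** (1 :: complex^'n^'n)) $ i $ j = hs 1 X" for i j
    by (simp add: matrix_matrix_mult_def hs_def) (rule sum.swap)
  then show ?thesis by (simp add: vec_eq_iff)
qed

theorem mainTheorem3:
  fixes G :: "'g::finite \<Rightarrow> 'g \<Rightarrow> bool" and H :: "'h::finite \<Rightarrow> 'h \<Rightarrow> bool"
  assumes "simple_graph G" and "simple_graph H"
  shows "psd_isomorphic G H \<longleftrightarrow>
    (\<exists>\<phi> :: complex^'g^'g \<Rightarrow> complex^'h^'h.
      bij_betw \<phi> (partially_coherent_algebra G) (partially_coherent_algebra H) \<and>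
      (\<forall>M\<in>partially_coherent_algebra G. \<forall>N\<in>partially_coherent_algebra G.
         \<phi> (M + N) = \<phi> M + \<phi> N) \<and>
      (\<forall>c. \<forall>M\<in>partially_coherent_algebra G. \<phi> (c *\<^sub>m M) = c *\<^sub>m \<phi> M) \<and>
      (\<forall>M\<in>partially_coherent_algebra G. \<phi> (ctranspose M) = ctranspose (\<phi> M)) \<and>
      (\<forall>M\<in>partially_coherent_algebra G. \<forall>N\<in>partially_coherent_algebra G.
         \<phi> (M ** N) = \<phi> M ** \<phi> N) \<and>
      \<phi> (mat 1) = mat 1 \<and> \<phi> (adj_matrix G) = adj_matrix H \<and> \<phi> all_ones = all_ones \<and>
      (\<forall>M\<in>{mat 1, adj_matrix G}. \<forall>N\<in>partially_coherent_algebra G.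
         \<phi> (M \<odot> N) = \<phi> M \<odot> \<phi> N))"
    (is "_ = (\<exists>\<phi>. ?iso \<phi>)")
proof
  have irrefl: "irreflp G" "irreflp H"
    using assms by (auto simp: simple_graph_def)
  {
    assume "psd_isomorphic G H"
    then obtain M where "psd_isomorphism G H M"
      using irrefl unfolding psd_isomorphic_def psd_isomorphism_def by blast
    then interpret psd_isomorphism G H M .
    show "\<exists>\<phi>. ?iso \<phi>"
    proof (intro exI[of _ "transfer M"] conjI ballI allI)
      fix X Y assume "X \<in> partially_coherent_algebra G" "Y \<in> partially_coherent_algebra G"
      then show "transfer M (X ** Y) = transfer M X ** transfer M Y"
        by (intro transfer_mult transfer_algebra)
    qed (auto simp: bij_betw_transfer transfer_add transfer_scale transfer_star transfer_one
        transfer_adj transfer_all_ones transfer_schur_one transfer_schur_adj)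
  }
  assume "\<exists>\<phi>. ?iso \<phi>"
  then obtain \<phi> where \<phi>: "?iso \<phi>" ..
  define A where "A = partially_coherent_algebra G"
  have A: "partially_coherent G A"
    unfolding A_def by (rule partially_coherent_algebra)
  then have "cmat.subspace A"
    by (simp add: partially_coherent_def)
  then obtain B where B: "finite B" "B \<subseteq> A" "\<And>Y. Y \<in> A \<Longrightarrow> (\<Sum>X\<in>B. hs X Y *\<^sub>m X) = Y"
    by (rule hs_frame) blast
  interpret framed_homomorphism A B \<phi>
    using A B \<phi> by unfold_locales (auto simp: partially_coherent_def simp flip: A_def)
  have one: "1 \<in> A" "\<phi> 1 = 1"
    using A \<phi> by (auto simp: partially_coherent_def)
  have schur: "P \<odot> Y \<in> A" "\<phi> (P \<odot> Y) = \<phi> P \<odot> \<phi> Y"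
    if "P \<in> {mat 1, adj_matrix G}" "Y \<in> A" for P Y
    using A \<phi> that unfolding partially_coherent_def A_def[symmetric] by blast+
  \<comment> \<open>Since \<open>\<phi>\<close> preserves the sum of the entries,
    \<open>all_ones\<close> is its own image under the adjoint of \<open>\<phi>\<close>, as
    \<open>choi_cotransfer\<close> requires.\<close>
  have hs_one: "hs 1 (\<phi> X) = hs 1 X" if "X \<in> A" for X
  proof -
    have "hs 1 (\<phi> X) *\<^sub>m 1 = \<phi> (1 ** X ** 1)"
      using that by (simp add: all_ones_conjugation[symmetric] \<phi>_mult mult_closed one)
    also have "\<dots> = hs 1 X *\<^sub>m 1"
      by (simp add: all_ones_conjugation \<phi>_scale one)
    finally show ?thesis by (simp add: vec_eq_iff)
  qed
  have diag: "(mat 1 :: complex^'g^'g) $ g $ g' * choi $ (g, h) $ (g', h')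
      = (mat 1 :: complex^'h^'h) $ h $ h' * choi $ (g, h) $ (g', h')"
    and adj: "adj_matrix G $ g $ g' * choi $ (g, h) $ (g', h')
      = adj_matrix H $ h $ h' * choi $ (g, h) $ (g', h')" for g g' h h'
    using schur \<phi> by (intro choi_schur; simp add: mat_nth)+
  \<comment> \<open>At a nonzero entry, \<open>diag\<close> makes equality agree in the two graphs
    and \<open>adj\<close> makes adjacency agree, so the relationships coincide.\<close>
  have "choi $ (g, h) $ (g', h') = 0" if "rel G g g' \<noteq> rel H h h'" for g h g' h'
    using that diag[of g g' h h'] adj[of g g' h h']
    by (auto simp: rel_def mat_nth split: if_splits)
  moreover have "(\<Sum>g\<in>UNIV. \<Sum>g'\<in>UNIV. choi $ (g, h) $ (g', h')) = 1" for h h'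
    using choi_transfer[OF one(1)] one(2) by simp
  moreover have "(\<Sum>h\<in>UNIV. \<Sum>h'\<in>UNIV. choi $ (g, h) $ (g', h')) = 1" for g g'
    using choi_cotransfer[of 1 1] one(1) hs_one by simp
  ultimately show "psd_isomorphic G H"
    unfolding psd_isomorphic_def using choi_psd by blast
qed

end
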